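(* $r\big(\mathfrak B(C),\ell_\infty^*\big)=2$, that is, $$\inf_{B_1\in\mathfrak B(C)}\ \sup_{B_2\in\mathfrak B(C)}\|B_1-B_2\|_{\ell_\infty^*}=2.$$
   Context: $\ell_\infty$ is the space of bounded real sequences with the sup norm and coordinatewise order, and $\ell_\infty^*$ is its dual with the dual norm. $T$ is the left shift, $T(x_1,x_2,x_3,\dots)=(x_2,x_3,x_4,\dots)$. A Banach limit is a functional $B\in\ell_\infty^*$ with $B\ge 0$ (i.e. $Bx\ge0$ whenever $x\ge0$), $B(1,1,1,\dots)=1$, and $B(Tx)=Bx$ for all $x\in\ell_\infty$. $\mathfrak B$ is the set of all Banach limits. $C$ is the Cesàro operator on $\ell_\infty$, $(Cx)_n=\frac1n\sum_{k=1}^n x_k$, and $\mathfrak B(C)=\{B\in\mathfrak B: B(Cx)=Bx\ \text{for all } x\in\ell_\infty\}$ (a non-empty set). For a subset $M$ of a normed space $E$, the radius is $r(M,E)=\inf_{x\in M}\sup_{y\in M}\|x-y\|_E$. *)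

theory Defs
  imports "HOL-Analysis.Analysis"
begin

text \<open>
  The topology of \<^typ>\<open>nat\<close> is discrete, so the bounded continuous functions on \<^typ>\<open>nat\<close>
  are exactly the bounded real sequences, with the sup norm. Sequences are indexed from \<open>0\<close>:
  the term \<open>x\<^sub>n\<close> of the mathematical text is \<open>x (n - 1)\<close> here.
\<close>

type_synonym linf = "nat \<Rightarrow>\<^sub>C real"

type_synonym linf_dual = "linf \<Rightarrow>\<^sub>L real"

context
  includes bcontfun.lifting
begin

lift_definition left_shift :: "linf \<Rightarrow> linf" is "\<lambda>x n. x (Suc n)"
proof -
  fix x :: "nat \<Rightarrow> real"
  assume "x \<in> bcontfun"
  then have "bounded (range x)"
    by (simp add: bcontfun_def)
  then have "bounded (range (\<lambda>n. x (Suc n)))"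
    by (rule bounded_subset) auto
  then show "(\<lambda>n. x (Suc n)) \<in> bcontfun"
    by (simp add: bcontfun_def)
qed

lift_definition cesaro :: "linf \<Rightarrow> linf" is "\<lambda>x n. (\<Sum>k\<le>n. x k) / real (Suc n)"
proof -
  fix x :: "nat \<Rightarrow> real"
  assume "x \<in> bcontfun"
  then obtain b where b: "\<And>n. \<bar>x n\<bar> \<le> b"
    by (auto simp: bcontfun_def bounded_iff)
  show "(\<lambda>n. (\<Sum>k\<le>n. x k) / real (Suc n)) \<in> bcontfun"
  proof (rule bcontfun_normI)
    fix n
    have "\<bar>\<Sum>k\<le>n. x k\<bar> \<le> (\<Sum>k\<le>n. \<bar>x k\<bar>)"
      by (rule sum_abs)
    also have "\<dots> \<le> real (Suc n) * b"
      using sum_bounded_above[of "{..n}" "\<lambda>k. \<bar>x k\<bar>" b] b by simp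
    finally show "norm ((\<Sum>k\<le>n. x k) / real (Suc n)) \<le> b"
      by (simp add: divide_le_eq mult.commute)
  qed simp
qed

end

definition banach_limits :: "linf_dual set" where
  "banach_limits =
    {B. (\<forall>x. (\<forall>n. 0 \<le> apply_bcontfun x n) \<longrightarrow> 0 \<le> blinfun_apply B x) \<and>
        blinfun_apply B (const_bcontfun 1) = 1 \<and>
        (\<forall>x. blinfun_apply B (left_shift x) = blinfun_apply B x)}"

definition cesaro_banach_limits :: "linf_dual set" where
  "cesaro_banach_limits =
    {B \<in> banach_limits. \<forall>x. blinfun_apply B (cesaro x) = blinfun_apply B x}"

text \<open>
  The radius is taken in the extended reals, so that infimum and supremum are the true ones
  even when the set is unbounded or empty; the space \<open>E\<close> is the type \<open>'a\<close>.
\<close>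

definition radius :: "'a::real_normed_vector set \<Rightarrow> ereal" where
  "radius M = (INF x\<in>M. SUP y\<in>M. ereal (norm (x - y)))"

end

theory Submission
  imports Defs
begin

text \<open>
  It suffices to find, for every \<open>N\<close>, disjoint sets \<open>A\<^sub>0, \<dots>, A\<^sub>N\<^sub>-\<^sub>1\<close> and functionals
  \<open>B\<^sub>i \<in> \<BB>(C)\<close> with \<open>B\<^sub>i(1\<^bsub>A\<^sub>i\<^esub>) = 1\<close>: any \<open>B \<in> \<BB>(C)\<close> satisfies \<open>B(1\<^bsub>A\<^sub>i\<^esub>) \<le> 1/N\<close> for some \<open>i\<close>, and
  testing on \<open>1 - 2 \<cdot> 1\<^bsub>A\<^sub>i\<^esub>\<close> gives \<open>\<parallel>B - B\<^sub>i\<parallel> \<ge> 2 - 2/N\<close>. The sets are unions of blocks \<open>(p\<^sub>k, p\<^sub>k\<^sub>+\<^sub>1]\<close>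
  over the residue classes of \<open>k\<close> modulo \<open>N\<close>, with \<open>p\<close> growing so fast that \<open>C\<^sup>j x (p\<^sub>k\<^sub>+\<^sub>1)\<close> hardly
  depends on the entries of \<open>x\<close> up to \<open>p\<^sub>k\<close>, for all \<open>j \<le> k\<close>. The functional \<open>B\<^sub>i\<close> is a cluster point of
  the means of \<open>C\<^sup>j x (p\<^sub>k\<^sub>+\<^sub>1)\<close> over \<open>j \<le> k\<close>. Telescoping makes it \<open>C\<close>-invariant, and shift invariance
  follows, since \<open>C(x - Tx)\<close> is dominated by a multiple of \<open>C e\<^sub>0\<close> for the first unit vector \<open>e\<^sub>0\<close>.
\<close>

section \<open>Cluster points of bounded families\<close>

text \<open>Tychonoff: every \<open>f i\<close> lies in the compact product of the intervals
  [-\<open>M a\<close>, \<open>M a\<close>]. A finer filter replaces a subsequence because the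
  points \<open>a\<close> will range over all of \<open>linf\<close>, where a bounded sequence of
  functionals need not have a pointwise convergent subsequence.\<close>

lemma pointwise_convergent_subfilter:
  fixes f :: "'i \<Rightarrow> 'a \<Rightarrow> real"
  assumes bound: "\<And>i a. \<bar>f i a\<bar> \<le> M a" and "F \<noteq> bot"
  obtains G L where "G \<le> F" "G \<noteq> bot" "\<And>a. ((\<lambda>i. f i a) \<longlongrightarrow> L a) G"
proof -
  define K where "K = PiE UNIV (\<lambda>a. {- M a..M a})"
  have "compact K"
    unfolding K_def compactin_euclidean_iff[symmetric] euclidean_product_topology[symmetric]
    by (subst compactin_PiE) simp
  have "f i \<in> K" for i
    unfolding K_def using bound[of i] by (auto simp: abs_le_iff minus_le_iff)
  then have "filtermap f F \<le> principal K"
    by (simp add: le_principal eventually_filtermap)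
  moreover have "filtermap f F \<noteq> bot"
    using \<open>F \<noteq> bot\<close> by (simp add: filtermap_bot_iff)
  ultimately obtain L where L: "inf (nhds L) (filtermap f F) \<noteq> bot"
    using \<open>compact K\<close>[unfolded compact_filter] unfolding le_principal by blast
  \<comment> \<open>Pulling the neighbourhoods of \<open>L\<close> back along \<open>f\<close>
    forces convergence to \<open>L\<close>; that \<open>L\<close> is a cluster point of the image
    filter keeps \<open>G\<close> proper.\<close>
  define G where "G = inf F (filtercomap f (nhds L))"
  show thesis
  proof
    show "G \<le> F"
      by (simp add: G_def)
    show "G \<noteq> bot"
    proof
      assume "G = bot"
      then have "eventually (\<lambda>_. False) G"
        by simp
      then obtain P Q where "eventually P F" "eventually Q (nhds L)" "\<And>i. \<not> (P i \<and> Q (f i))"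
        unfolding G_def eventually_inf eventually_filtercomap by blast
      then have "eventually (\<lambda>y. \<not> Q y) (filtermap f F)" "eventually Q (nhds L)"
        by (auto simp: eventually_filtermap elim: eventually_mono)
      then have "eventually (\<lambda>_. False) (inf (nhds L) (filtermap f F))"
        unfolding eventually_inf by blast
      then show False
        using L by (simp add: trivial_limit_def)
    qed
    have "filterlim f (nhds L) G"
      unfolding G_def by (rule filterlim_mono[OF filterlim_filtercomap order_refl inf_le2])
    then have lim: "eventually (\<lambda>i. f i \<in> U) G" if "open U" "L \<in> U" for U
      using that by (rule topological_tendstoD)
    show "((\<lambda>i. f i a) \<longlongrightarrow> L a) G" for a
    proof (rule topological_tendstoI)
      fix S :: "real set"
      assume "open S" "L a \<in> S"
      have "open ((\<lambda>g. g a) -` S :: ('a \<Rightarrow> real) set)"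
        by (rule open_vimage[OF \<open>open S\<close> continuous_on_product_coordinates])
      from lim[OF this] show "eventually (\<lambda>i. f i a \<in> S) G"
        using \<open>L a \<in> S\<close> by simp
    qed
  qed
qed

section \<open>Iterates of the Cesaro operator\<close>

lemma cesaro_apply: "cesaro x n = (\<Sum>k\<le>n. x k) / real (Suc n)"
  by (simp add: cesaro.rep_eq)

lemma linear_cesaro: "linear cesaro"
  by (rule linearI; rule bcontfun_eqI)
    (simp_all add: cesaro_apply sum.distrib add_divide_distrib sum_distrib_left del: of_nat_Suc)

lemma linear_cesaro_funpow: "linear (cesaro ^^ j)"
proof (induction j)
  case (Suc j)
  then show ?case
    using linear_compose[OF Suc.IH linear_cesaro] by (simp add: o_def)
qed (simp add: id_def linear_ident)

text \<open>An entry of a Cesaro mean involves no later entries of the sequence. Comparison up to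
  \<open>m\<close> only is what the block argument needs, as nothing is known there beyond the end
  of a block.\<close>

lemma cesaro_funpow_mono:
  assumes "\<And>n. n \<le> m \<Longrightarrow> apply_bcontfun x n \<le> apply_bcontfun y n" and "n \<le> m"
  shows "(cesaro ^^ j) x n \<le> (cesaro ^^ j) y n"
  using \<open>n \<le> m\<close>
proof (induction j arbitrary: n)
  case (Suc j)
  then show ?case
    by (auto simp: cesaro_apply simp del: of_nat_Suc intro!: divide_right_mono sum_mono)
qed (use assms in simp)

lemma cesaro_const: "cesaro (const_bcontfun c) = const_bcontfun c"
  by (rule bcontfun_eqI) (simp add: cesaro_apply const_bcontfun.rep_eq del: of_nat_Suc)

lemma cesaro_funpow_const: "(cesaro ^^ j) (const_bcontfun c) = const_bcontfun c"
  by (induction j) (simp_all add: cesaro_const)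

lemma abs_cesaro_funpow_le: "\<bar>(cesaro ^^ j) x n\<bar> \<le> norm x"
proof -
  have b: "\<bar>x k\<bar> \<le> norm x" for k
    using norm_bounded[of x k] by simp
  have "(cesaro ^^ j) x n \<le> (cesaro ^^ j) (const_bcontfun (norm x)) n"
    by (rule cesaro_funpow_mono[of n]) (use b in \<open>auto simp: const_bcontfun.rep_eq abs_le_iff\<close>)
  moreover have "(cesaro ^^ j) (const_bcontfun (- norm x)) n \<le> (cesaro ^^ j) x n"
    by (rule cesaro_funpow_mono[of n])
      (use b in \<open>auto simp: const_bcontfun.rep_eq abs_le_iff minus_le_iff\<close>)
  ultimately show ?thesis
    by (simp add: cesaro_funpow_const const_bcontfun.rep_eq)
qed

lemma cesaro_tendsto_0:
  assumes "apply_bcontfun x \<longlonglongrightarrow> 0"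
  shows "apply_bcontfun (cesaro x) \<longlonglongrightarrow> 0"
proof (rule LIMSEQ_I)
  fix e :: real
  assume "0 < e"
  then obtain N where N: "\<And>k. k \<ge> N \<Longrightarrow> \<bar>x k\<bar> < e / 2"
    using LIMSEQ_D[OF assms, of "e / 2"] by auto
  define S where "S = (\<Sum>k<N. \<bar>x k\<bar>)"
  \<comment> \<open>Beyond \<open>M\<close> the fixed initial sum \<open>S\<close> contributes less
    than \<open>e / 2\<close> to the mean.\<close>
  obtain M where M: "2 * S / e < real M"
    using reals_Archimedean2 by blast
  show "\<exists>M. \<forall>n\<ge>M. norm (cesaro x n - 0) < e"
  proof (intro exI allI impI)
    fix n
    assume "n \<ge> M"
    have "\<bar>\<Sum>k\<le>n. x k\<bar> \<le> (\<Sum>k\<le>n. \<bar>x k\<bar>)"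
      by (rule sum_abs)
    also have "\<dots> \<le> (\<Sum>k\<le>n. (if k < N then \<bar>x k\<bar> else 0) + e / 2)"
      using N \<open>0 < e\<close> by (intro sum_mono) (auto simp: not_less less_imp_le)
    also have "\<dots> = (\<Sum>k\<in>{..n} \<inter> {k. k < N}. \<bar>x k\<bar>) + real (Suc n) * (e / 2)"
      by (simp add: sum.distrib sum.If_cases)
    also have "(\<Sum>k\<in>{..n} \<inter> {k. k < N}. \<bar>x k\<bar>) \<le> S"
      unfolding S_def by (rule sum_mono2) auto
    also have "S < real (Suc n) * (e / 2)"
    proof -
      have "S < real M * (e / 2)"
        using M \<open>0 < e\<close> by (simp add: field_simps)
      also have "\<dots> \<le> real (Suc n) * (e / 2)"
        using \<open>0 < e\<close> \<open>n \<ge> M\<close> by (intro mult_right_mono) auto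
      finally show ?thesis .
    qed
    finally show "norm (cesaro x n - 0) < e"
      by (simp add: cesaro_apply divide_less_eq mult.commute del: of_nat_Suc)
  qed
qed

lemma cesaro_funpow_tendsto_0:
  assumes "apply_bcontfun x \<longlonglongrightarrow> 0"
  shows "apply_bcontfun ((cesaro ^^ j) x) \<longlonglongrightarrow> 0"
  by (induction j) (simp_all add: assms cesaro_tendsto_0)

section \<open>Indicators and Banach limits\<close>

definition ind :: "nat set \<Rightarrow> linf" where
  "ind A = Bcontfun (indicator A)"

lemma ind_apply: "ind A n = indicator A n"
proof -
  have "(indicator A :: nat \<Rightarrow> real) \<in> bcontfun"
    by (rule bcontfun_normI[of _ 1]) (auto simp: indicator_def)
  then show ?thesis
    by (simp add: ind_def Bcontfun_inverse)
qed

lemma ind_atMost_tendsto_0: "apply_bcontfun (ind {..a}) \<longlonglongrightarrow> 0"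
  by (rule tendsto_eventually, rule eventually_sequentiallyI[of "Suc a"]) (simp add: ind_apply)

lemma banach_limit_mono:
  assumes "B \<in> banach_limits" "\<And>n. apply_bcontfun x n \<le> apply_bcontfun y n"
  shows "blinfun_apply B x \<le> blinfun_apply B y"
proof -
  have "0 \<le> blinfun_apply B (y - x)"
    using assms by (auto simp: banach_limits_def)
  then show ?thesis
    by (simp add: blinfun.diff_right)
qed

lemma const_bcontfun_eq_scaleR: "const_bcontfun (c :: real) = c *\<^sub>R const_bcontfun 1"
  by (rule bcontfun_eqI) (simp add: const_bcontfun.rep_eq)

lemma banach_limit_const:
  assumes "B \<in> banach_limits"
  shows "blinfun_apply B (const_bcontfun c) = c"
  using assms by (subst const_bcontfun_eq_scaleR) (simp add: banach_limits_def blinfun.scaleR_right)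

lemma banach_limit_norm_le_1:
  assumes "B \<in> banach_limits"
  shows "norm B \<le> 1"
proof (rule norm_blinfun_bound)
  fix x :: linf
  have b: "\<bar>x k\<bar> \<le> norm x" for k
    using norm_bounded[of x k] by simp
  have "blinfun_apply B x \<le> blinfun_apply B (const_bcontfun (norm x))"
    by (rule banach_limit_mono[OF assms]) (use b in \<open>auto simp: const_bcontfun.rep_eq abs_le_iff\<close>)
  moreover have "blinfun_apply B (const_bcontfun (- norm x)) \<le> blinfun_apply B x"
    by (rule banach_limit_mono[OF assms])
      (use b in \<open>auto simp: const_bcontfun.rep_eq abs_le_iff minus_le_iff\<close>)
  ultimately show "norm (blinfun_apply B x) \<le> 1 * norm x"
    by (simp add: banach_limit_const[OF assms])
qed simp

text \<open>The partial sums of x - Tx telescope to two boundary terms, and 1/(n+1) is the Cesaro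
  mean of the first unit vector.\<close>

lemma cesaro_diff_left_shift_le:
  "\<bar>cesaro (x - left_shift x) n\<bar> \<le> cesaro ((2 * norm x) *\<^sub>R ind {0}) n"
proof -
  have b: "\<bar>x k\<bar> \<le> norm x" for k
    using norm_bounded[of x k] by simp
  have "(\<Sum>k\<le>n. x k - x (Suc k)) = x 0 - x (Suc n)"
    by (rule sum_telescope)
  then have "\<bar>cesaro (x - left_shift x) n\<bar> = \<bar>x 0 - x (Suc n)\<bar> / real (Suc n)"
    by (simp add: cesaro_apply left_shift.rep_eq del: of_nat_Suc)
  also have "\<dots> \<le> 2 * norm x / real (Suc n)"
    using b[of 0] b[of "Suc n"] by (intro divide_right_mono) auto
  also have "(\<Sum>k\<le>n. indicator {0} k :: real) = 1"
    by (simp add: indicator_def of_bool_def)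
  then have "2 * norm x / real (Suc n) = cesaro ((2 * norm x) *\<^sub>R ind {0}) n"
    by (simp add: cesaro_apply ind_apply sum_distrib_left[symmetric] del: of_nat_Suc)
  finally show ?thesis .
qed

text \<open>Trades shift invariance for the single condition \<open>zero\<close>: B(x - Tx) = B(C(x
  - Tx)) is squeezed by positivity between multiples of B(C e0) = B(e0) = 0.\<close>

lemma cesaro_banach_limitI:
  assumes pos: "\<And>x. (\<And>n. 0 \<le> apply_bcontfun x n) \<Longrightarrow> 0 \<le> blinfun_apply B x"
    and one: "blinfun_apply B (const_bcontfun 1) = 1"
    and ces: "\<And>x. blinfun_apply B (cesaro x) = blinfun_apply B x"
    and zero: "blinfun_apply B (ind {0}) = 0"
  shows "B \<in> cesaro_banach_limits"
proof -
  have "blinfun_apply B (left_shift x) = blinfun_apply B x" for x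
  proof -
    define y where "y = cesaro ((2 * norm x) *\<^sub>R ind {0})"
    define z where "z = cesaro (x - left_shift x)"
    have "blinfun_apply B y = 0"
      by (simp add: y_def ces blinfun.scaleR_right zero)
    moreover have le: "\<bar>z n\<bar> \<le> y n" for n
      unfolding y_def z_def by (rule cesaro_diff_left_shift_le)
    have "0 \<le> blinfun_apply B (y - z)" "0 \<le> blinfun_apply B (y + z)"
      using abs_le_D1[OF le] abs_le_D2[OF le] by (auto intro!: pos simp: add.commute minus_le_iff real_0_le_add_iff)
    ultimately have "blinfun_apply B z = 0"
      by (simp add: blinfun.diff_right blinfun.add_right)
    then show ?thesis
      by (simp add: z_def ces blinfun.diff_right)
  qed
  then show ?thesis
    using assms by (auto simp: cesaro_banach_limits_def banach_limits_def)
qed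

section \<open>Invariant functionals concentrated on unions of blocks\<close>

lemma cesaro_banach_limit_concentrated:
  fixes a b :: "nat \<Rightarrow> nat"
  assumes blocks: "\<And>m. {a m<..b m} \<subseteq> A"
    and small: "\<And>m j. j \<le> m \<Longrightarrow> (cesaro ^^ j) (ind {..a m}) (b m) \<le> 1 / real (Suc m)"
  shows "\<exists>B\<in>cesaro_banach_limits. blinfun_apply B (ind A) = 1"
proof -
  define f where "f m x = (\<Sum>j\<le>m. (cesaro ^^ j) x (b m)) / real (Suc m)" for m x
  have f_mono: "f m x \<le> f m y" if "\<And>n. n \<le> b m \<Longrightarrow> apply_bcontfun x n \<le> apply_bcontfun y n" for m x y
    unfolding f_def using that
    by (intro divide_right_mono sum_mono cesaro_funpow_mono[of "b m"]) auto
  have f_add: "f m (x + y) = f m x + f m y" for m x y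
    by (simp add: f_def linear_add[OF linear_cesaro_funpow] sum.distrib add_divide_distrib)
  have f_scaleR: "f m (c *\<^sub>R x) = c * f m x" for m c x
    by (simp add: f_def linear_scale[OF linear_cesaro_funpow] sum_distrib_left)
  have f_const: "f m (const_bcontfun c) = c" for m c
    by (simp add: f_def cesaro_funpow_const const_bcontfun.rep_eq del: of_nat_Suc)
  have f_bound: "\<bar>f m x\<bar> \<le> norm x" for m x
  proof -
    have "\<bar>\<Sum>j\<le>m. (cesaro ^^ j) x (b m)\<bar> \<le> (\<Sum>j\<le>m. norm x)"
      by (rule order_trans[OF sum_abs]) (intro sum_mono abs_cesaro_funpow_le)
    then show ?thesis
      by (simp add: f_def divide_le_eq mult.commute del: of_nat_Suc)
  qed
  have f_small: "f m (ind {..a m}) \<le> 1 / real (Suc m)" for m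
  proof -
    have "(\<Sum>j\<le>m. (cesaro ^^ j) (ind {..a m}) (b m)) \<le> (\<Sum>j\<le>m. 1 / real (Suc m))"
      by (intro sum_mono small) simp
    then show ?thesis
      by (simp add: f_def divide_le_eq del: of_nat_Suc)
  qed
  have f_cesaro: "\<bar>f m (cesaro x) - f m x\<bar> \<le> 2 * norm x / real (Suc m)" for m x
  proof -
    have "f m (cesaro x) - f m x =
        (\<Sum>j\<le>m. (cesaro ^^ Suc j) x (b m) - (cesaro ^^ j) x (b m)) / real (Suc m)"
      by (simp add: f_def funpow_swap1 sum_subtractf diff_divide_distrib del: of_nat_Suc)
    \<comment> \<open>Averaging over the iterates leaves only the first and last terms, so the
      invariance defect of \<open>f m\<close> is O(1/m).\<close>
    also have "(\<Sum>j\<le>m. (cesaro ^^ Suc j) x (b m) - (cesaro ^^ j) x (b m)) =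
        (cesaro ^^ Suc m) x (b m) - x (b m)"
      using sum_telescope[of "\<lambda>j. - (cesaro ^^ j) x (b m)" m] by simp
    finally have "\<bar>f m (cesaro x) - f m x\<bar> = \<bar>(cesaro ^^ Suc m) x (b m) - x (b m)\<bar> / real (Suc m)"
      by simp
    also have "\<dots> \<le> 2 * norm x / real (Suc m)"
      using abs_cesaro_funpow_le[of "Suc m" x "b m"] abs_cesaro_funpow_le[of 0 x "b m"]
      by (intro divide_right_mono) auto
    finally show ?thesis .
  qed
  obtain G L where G: "G \<le> sequentially" "G \<noteq> bot" and lim: "\<And>x. ((\<lambda>m. f m x) \<longlongrightarrow> L x) G"
    using pointwise_convergent_subfilter[of f norm sequentially] f_bound by (metis sequentially_bot)
  have vanish: "((\<lambda>m. c / real (Suc m)) \<longlongrightarrow> 0) G" for c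
    using tendsto_mono[OF G(1) LIMSEQ_Suc[OF lim_const_over_n[of c]]] by simp
  have "bounded_linear L"
  proof (rule bounded_linear_intro)
    show "L (x + y) = L x + L y" for x y
      by (rule tendsto_unique[OF G(2) lim]) (simp only: f_add tendsto_add lim)
    show "L (c *\<^sub>R x) = c *\<^sub>R L x" for c x
      by (rule tendsto_unique[OF G(2) lim])
        (simp only: f_scaleR real_scaleR_def tendsto_mult_left lim)
    show "norm (L x) \<le> norm x * 1" for x
      using tendsto_upperbound[OF tendsto_rabs[OF lim] _ G(2)] f_bound by simp
  qed
  then have B: "blinfun_apply (Blinfun L) = L"
    by (rule bounded_linear_Blinfun_apply)
  have one: "L (const_bcontfun 1) = 1"
    by (rule tendsto_unique[OF G(2) lim]) (simp add: f_const)
  have ind_A: "L (ind A) = 1"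
  proof (rule antisym)
    have "f m (ind A) \<le> 1" for m
      using f_mono[of m "ind A" "const_bcontfun 1"]
      by (simp add: f_const ind_apply const_bcontfun.rep_eq indicator_def)
    then show "L (ind A) \<le> 1"
      by (intro tendsto_upperbound[OF lim _ G(2)]) simp
    have "1 - 1 / real (Suc m) \<le> f m (ind A)" for m
    proof -
      have "1 = f m (const_bcontfun 1)"
        by (simp add: f_const)
      \<comment> \<open>The two sets cover the indices up to \<open>b m\<close>, perhaps not all of
        them; the local form of \<open>f_mono\<close> suffices.\<close>
      also have "\<dots> \<le> f m (ind {..a m} + ind A)"
        using blocks[of m]
        by (intro f_mono) (auto simp: ind_apply const_bcontfun.rep_eq indicator_def not_le)
      finally show ?thesis
        using f_small[of m] by (simp add: f_add)
    qed
    then have "1 - 0 \<le> L (ind A)"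
      by (intro tendsto_le[OF G(2) lim tendsto_diff[OF tendsto_const vanish[of 1]]]) simp
    then show "1 \<le> L (ind A)"
      by simp
  qed
  have "Blinfun L \<in> cesaro_banach_limits"
  proof (rule cesaro_banach_limitI; unfold B)
    show "0 \<le> L x" if "\<And>n. 0 \<le> apply_bcontfun x n" for x
    proof (rule tendsto_lowerbound[OF lim _ G(2)])
      have "0 \<le> f m x" for m
        using f_mono[of m "const_bcontfun 0" x] that by (simp add: f_const[of _ 0, simplified])
      then show "\<forall>\<^sub>F m in G. 0 \<le> f m x"
        by simp
    qed
    show "L (cesaro x) = L x" for x
    proof -
      have "((\<lambda>m. f m (cesaro x) - f m x) \<longlongrightarrow> 0) G"
        by (rule Lim_null_comparison[OF _ vanish[of "2 * norm x"]]) (use f_cesaro[of _ x] in simp)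
      then have "L (cesaro x) - L x = 0"
        by (rule tendsto_unique[OF G(2) tendsto_diff[OF lim lim]])
      then show ?thesis
        by simp
    qed
    show "L (ind {0}) = 0"
    proof -
      \<comment> \<open>Index 0 lies in every initial segment \<open>{..a m}\<close>, so the
        smallness that gives concentration on \<open>A\<close> also yields
        \<open>zero\<close>.\<close>
      have "0 \<le> f m (ind {0})" "f m (ind {0}) \<le> 1 / real (Suc m)" for m
        using f_mono[of m "const_bcontfun 0" "ind {0}"] f_mono[of m "ind {0}" "ind {..a m}"] f_small[of m]
        by (auto simp: ind_apply indicator_def f_const[of _ 0, simplified])
      then have "((\<lambda>m. f m (ind {0})) \<longlongrightarrow> 0) G"
        by (intro Lim_null_comparison[OF _ vanish[of 1]]) simp
      then show ?thesis
        by (rule tendsto_unique[OF G(2) lim])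
    qed
  qed (rule one)
  then show ?thesis
    using ind_A B by metis
qed

text \<open>Each iterate of C maps the null sequence \<open>ind {..r}\<close> to a null sequence,
  and finitely many iterates admit a common late index \<open>q\<close>. The restriction to
  \<open>j \<le> k\<close> matters: at a fixed index the iterates of C on \<open>ind {..r}\<close>
  tend to 1.\<close>

lemma sparse_blocks_exist:
  obtains p :: "nat \<Rightarrow> nat" where "strict_mono p"
    "\<And>k j. j \<le> k \<Longrightarrow> (cesaro ^^ j) (ind {..p k}) (p (Suc k)) \<le> 1 / real (Suc k)"
proof -
  have "\<exists>q>r. \<forall>j\<le>k. (cesaro ^^ j) (ind {..r}) q \<le> 1 / real (Suc k)" for k r
  proof -
    have "\<forall>\<^sub>F q in sequentially. (cesaro ^^ j) (ind {..r}) q < 1 / real (Suc k)" for j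
      by (rule order_tendstoD(2)[OF cesaro_funpow_tendsto_0[OF ind_atMost_tendsto_0]]) simp
    then have "\<forall>\<^sub>F q in sequentially. \<forall>j\<in>{..k}. (cesaro ^^ j) (ind {..r}) q < 1 / real (Suc k)"
      by (intro eventually_ball_finite) auto
    then have "\<forall>\<^sub>F q in sequentially. q > r \<and> (\<forall>j\<in>{..k}. (cesaro ^^ j) (ind {..r}) q < 1 / real (Suc k))"
      by (intro eventually_conj eventually_gt_at_top)
    then obtain q where "q > r" "\<forall>j\<in>{..k}. (cesaro ^^ j) (ind {..r}) q < 1 / real (Suc k)"
      by (metis (no_types, lifting) eventually_happens' sequentially_bot)
    then show ?thesis
      by (auto intro: less_imp_le)
  qed
  then obtain p :: "nat \<Rightarrow> nat" where "\<forall>k. p k < p (Suc k) \<and>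
      (\<forall>j\<le>k. (cesaro ^^ j) (ind {..p k}) (p (Suc k)) \<le> 1 / real (Suc k))"
    using dependent_nat_choice[where P = "\<lambda>_ _. True" and
      Q = "\<lambda>k r q. r < q \<and> (\<forall>j\<le>k. (cesaro ^^ j) (ind {..r}) q \<le> 1 / real (Suc k))"] by auto
  then show thesis
    by (intro that[of p]) (auto simp: strict_mono_Suc_iff)
qed

lemma cesaro_banach_limits_disjointly_concentrated:
  assumes "0 < N"
  obtains A :: "nat \<Rightarrow> nat set" where "disjoint_family A"
    "\<And>i. i < N \<Longrightarrow> \<exists>B\<in>cesaro_banach_limits. blinfun_apply B (ind (A i)) = 1"
proof -
  obtain p where p: "strict_mono p"
    and small: "\<And>k j. j \<le> k \<Longrightarrow> (cesaro ^^ j) (ind {..p k}) (p (Suc k)) \<le> 1 / real (Suc k)"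
    using sparse_blocks_exist by blast
  \<comment> \<open>For \<open>i \<ge> N\<close> this is empty, so the family is disjoint over all
    of \<open>nat\<close>.\<close>
  define A where "A i = (\<Union>k\<in>{k. k mod N = i}. {p k<..p (Suc k)})" for i
  have "k = l" if "n \<in> {p k<..p (Suc k)}" "n \<in> {p l<..p (Suc l)}" for k l n
  proof -
    have "p k < p (Suc l)" "p l < p (Suc k)"
      using that by auto
    then show ?thesis
      by (simp add: strict_mono_less[OF p])
  qed
  then have "disjoint_family A"
    unfolding disjoint_family_on_def A_def by blast
  moreover have "\<exists>B\<in>cesaro_banach_limits. blinfun_apply B (ind (A i)) = 1" if "i < N" for i
  proof (rule cesaro_banach_limit_concentrated)
    \<comment> \<open>The \<open>m\<close>-th block of class \<open>i\<close> has index
      \<open>N * m + i\<close>, which is at least \<open>m\<close>, so its estimate is at least as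
      strong as required.\<close>
    show "{p (N * m + i)<..p (Suc (N * m + i))} \<subseteq> A i" for m
      unfolding A_def using that by (intro UN_upper) simp
    fix m j :: nat
    assume "j \<le> m"
    have "m \<le> N * m + i"
      using assms by (simp add: trans_le_add1)
    then have "(cesaro ^^ j) (ind {..p (N * m + i)}) (p (Suc (N * m + i))) \<le> 1 / real (Suc (N * m + i))"
      using \<open>j \<le> m\<close> by (intro small) linarith
    also have "\<dots> \<le> 1 / real (Suc m)"
      using \<open>m \<le> N * m + i\<close> by (intro divide_left_mono) (simp_all del: of_nat_Suc)
    finally show "(cesaro ^^ j) (ind {..p (N * m + i)}) (p (Suc (N * m + i))) \<le> 1 / real (Suc m)" .
  qed
  ultimately show thesis
    by (rule that)
qed

section \<open>Distance estimates and the radius\<close>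

lemma sum_banach_limit_ind_le_1:
  fixes N :: nat
  assumes "B \<in> banach_limits" "disjoint_family A"
  shows "(\<Sum>i<N. blinfun_apply B (ind (A i))) \<le> 1"
proof -
  have "(\<Sum>i<N. ind (A i)) = ind (\<Union>i<N. A i)"
  proof (induction N)
    case (Suc N)
    have "A i \<inter> A N = {}" if "i < N" for i
      using that by (intro disjoint_family_onD[OF assms(2)]) auto
    then have "(\<Union>i<N. A i) \<inter> A N = {}"
      by blast
    then have "ind (\<Union>i<Suc N. A i) = ind (\<Union>i<N. A i) + ind (A N)"
      by (intro bcontfun_eqI) (auto simp: ind_apply lessThan_Suc indicator_def)
    then show ?case
      using Suc by simp
  qed (auto intro: bcontfun_eqI simp: ind_apply)
  then have "(\<Sum>i<N. blinfun_apply B (ind (A i))) = blinfun_apply B (ind (\<Union>i<N. A i))"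
    by (simp flip: blinfun.sum_right)
  also have "\<dots> \<le> blinfun_apply B (const_bcontfun 1)"
    by (rule banach_limit_mono[OF assms(1)])
      (simp add: ind_apply const_bcontfun.rep_eq indicator_def)
  finally show ?thesis
    by (simp add: banach_limit_const[OF assms(1)])
qed

lemma norm_diff_banach_limits_ge:
  assumes "B \<in> banach_limits" "B' \<in> banach_limits"
  shows "2 * (blinfun_apply B' (ind A) - blinfun_apply B (ind A)) \<le> norm (B - B')"
proof -
  \<comment> \<open>Takes the values 1 and -1 only; the constant part cancels in
    \<open>B - B'\<close>.\<close>
  define u where "u = const_bcontfun 1 - 2 *\<^sub>R ind A"
  have "norm u \<le> 1"
    by (rule norm_bound) (simp add: u_def ind_apply const_bcontfun.rep_eq indicator_def)
  have "2 * (blinfun_apply B' (ind A) - blinfun_apply B (ind A)) = blinfun_apply (B - B') u"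
    using assms
    by (simp add: u_def blinfun.diff_left blinfun.diff_right blinfun.scaleR_right banach_limit_const)
  also have "\<dots> \<le> norm (B - B') * norm u"
    using norm_blinfun[of "B - B'" u] by simp
  also have "\<dots> \<le> norm (B - B')"
    using \<open>norm u \<le> 1\<close> by (simp add: mult_left_le)
  finally show ?thesis .
qed

lemma exists_far_cesaro_banach_limit:
  assumes "B \<in> cesaro_banach_limits" "0 < e"
  shows "\<exists>B'\<in>cesaro_banach_limits. 2 - e \<le> norm (B - B')"
proof -
  have B: "B \<in> banach_limits"
    using assms(1) by (simp add: cesaro_banach_limits_def)
  \<comment> \<open>\<open>N\<close> values all above \<open>e / 2\<close> would then add up to more
    than 1.\<close>
  obtain N where N: "0 < N" "2 / e < real N"
    using reals_Archimedean2[of "max (2 / e) 0"] by auto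
  obtain A where A: "disjoint_family A"
    "\<And>i. i < N \<Longrightarrow> \<exists>B\<in>cesaro_banach_limits. blinfun_apply B (ind (A i)) = 1"
    using cesaro_banach_limits_disjointly_concentrated[OF N(1)] by metis
  have "\<exists>i<N. blinfun_apply B (ind (A i)) \<le> e / 2"
  proof (rule ccontr)
    assume "\<not> ?thesis"
    then have "(\<Sum>i<N. e / 2) \<le> (\<Sum>i<N. blinfun_apply B (ind (A i)))"
      by (intro sum_mono) (auto simp: not_le less_imp_le)
    also have "\<dots> \<le> 1"
      by (rule sum_banach_limit_ind_le_1[OF B A(1)])
    finally show False
      using N \<open>0 < e\<close> by (simp add: field_simps)
  qed
  then obtain i where i: "i < N" "blinfun_apply B (ind (A i)) \<le> e / 2"
    by blast
  then obtain B' where B': "B' \<in> cesaro_banach_limits" "blinfun_apply B' (ind (A i)) = 1"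
    using A(2) by blast
  have "2 * (blinfun_apply B' (ind (A i)) - blinfun_apply B (ind (A i))) \<le> norm (B - B')"
    using B B'(1) by (intro norm_diff_banach_limits_ge) (simp_all add: cesaro_banach_limits_def)
  then show ?thesis
    using B' i by (intro bexI[of _ B']) auto
qed

theorem theorem3p4:
  shows "radius cesaro_banach_limits = 2"
proof (rule antisym)
  have le: "norm (B - B') \<le> 2" if "B \<in> cesaro_banach_limits" "B' \<in> cesaro_banach_limits" for B B'
    using that norm_triangle_ineq4[of B B'] banach_limit_norm_le_1[of B] banach_limit_norm_le_1[of B']
    by (simp add: cesaro_banach_limits_def)
  \<comment> \<open>Non-emptiness, from the case of a single class: an infimum over the empty set
    would be infinite.\<close>
  obtain B where "B \<in> cesaro_banach_limits"
    using cesaro_banach_limits_disjointly_concentrated[of 1] by (metis zero_less_one)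
  then show "radius cesaro_banach_limits \<le> 2"
    unfolding radius_def by (intro INF_lower2[of B] SUP_least) (use le in auto)
  show "2 \<le> radius cesaro_banach_limits"
    unfolding radius_def
  proof (rule INF_greatest, rule ereal_le_epsilon2)
    fix B and e :: real
    assume "B \<in> cesaro_banach_limits" "0 < e"
    then obtain B' where "B' \<in> cesaro_banach_limits" "2 - e \<le> norm (B - B')"
      using exists_far_cesaro_banach_limit by blast
    then have "ereal (2 - e) \<le> (SUP y\<in>cesaro_banach_limits. ereal (norm (B - y)))"
      by (intro SUP_upper2[of B']) auto
    then have "ereal (2 - e) + ereal e \<le> (SUP y\<in>cesaro_banach_limits. ereal (norm (B - y))) + ereal e"
      by (rule add_right_mono)
    then show "2 \<le> (SUP y\<in>cesaro_banach_limits. ereal (norm (B - y))) + ereal e"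
      by simp
  qed
qed

end
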